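(* Let $n$ and $k$, $0\le k\le n$, be integers. The number $P_{(x_{12}x_{23})^n(x_{34})^k}(\beta=0)$ is equal to the number of $n$ up, $n$ down, $k$ up permutations in the symmetric group $\mathbb{S}_{2n+k+1}$, that is, the number of $\sigma\in\mathbb{S}_{2n+k+1}$ with $$\sigma(1)<\cdots<\sigma(n+1)>\sigma(n+2)>\cdots>\sigma(2n+1)<\sigma(2n+2)<\cdots<\sigma(2n+k+1).$$
   Context: For a monomial $M$ in commuting variables $x_{ij}$, $i<j$, over $\mathbb{Z}[\beta]$, a reduced polynomial of $M$ is obtained by repeatedly replacing (in any monomial) a product $x_{ij}x_{jk}$, $i<j<k$, by $x_{ik}x_{ij}+x_{jk}x_{ik}+\beta x_{ik}$, until no monomial contains such a product. $P_M(\beta)$ denotes the value of the reduced polynomial at $x_{ij}=1$ for all $i<j$ (the replacements are applied successively starting from the leftmost variables $x_{12}^{m_1}x_{23}$). *)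

theory Defs
  imports
    "HOL-Library.Multiset"
    "HOL-Library.Poly_Mapping"
    "HOL-Computational_Algebra.Polynomial"
    "HOL-Combinatorics.Permutations"
begin

text \<open>
  A monomial in commuting variables \<open>x\<^sub>i\<^sub>j\<close> is the multiset of its index pairs \<open>(i, j)\<close>;
  polynomials over \<open>\<int>[\<beta>]\<close> are finitely supported maps from monomials to \<open>int poly\<close>, whose ring
  structure (convolution product) is the one from \<open>Poly_Mapping\<close>.
\<close>

type_synonym monomial = "(nat \<times> nat) multiset"
type_synonym xpoly = "monomial \<Rightarrow>\<^sub>0 int poly"

definition xvar :: "nat \<Rightarrow> nat \<Rightarrow> xpoly" where
  "xvar i j = Poly_Mapping.single {#(i, j)#} 1"

definition beta :: xpoly where
  "beta = Poly_Mapping.single {#} [:0, 1:]"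

definition eval_at :: "(nat \<times> nat \<Rightarrow> int poly) \<Rightarrow> xpoly \<Rightarrow> int poly" where
  "eval_at f p = (\<Sum>M\<in>Poly_Mapping.keys p. Poly_Mapping.lookup p M * (\<Prod>e\<in>#M. f e))"

definition reducible_at :: "monomial \<Rightarrow> nat \<Rightarrow> nat \<Rightarrow> nat \<Rightarrow> bool" where
  "reducible_at M i j k \<longleftrightarrow> i < j \<and> j < k \<and> {#(i, j), (j, k)#} \<subseteq># M"

text \<open>
  The product \<open>x\<^sub>i\<^sub>j x\<^sub>j\<^sub>k\<close> is the leftmost reducible one in \<open>M\<close> if \<open>(i, j, k)\<close> is lexicographically
  minimal.  (Reduced polynomials in commuting variables depend on the order of the
  replacements, so an order is fixed.)
\<close>

definition leftmost_at :: "monomial \<Rightarrow> nat \<Rightarrow> nat \<Rightarrow> nat \<Rightarrow> bool" where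
  "leftmost_at M i j k \<longleftrightarrow> reducible_at M i j k \<and>
     (\<forall>i' j' k'. reducible_at M i' j' k' \<longrightarrow>
        i < i' \<or> (i = i' \<and> (j < j' \<or> (j = j' \<and> k \<le> k'))))"

text \<open>
  One replacement: in a term \<open>c \<cdot> N x\<^sub>i\<^sub>j x\<^sub>j\<^sub>k\<close> of \<open>p\<close>, the leftmost reducible product is replaced
  by \<open>x\<^sub>i\<^sub>k x\<^sub>i\<^sub>j + x\<^sub>j\<^sub>k x\<^sub>i\<^sub>k + \<beta> x\<^sub>i\<^sub>k\<close>.
\<close>

inductive replacement :: "xpoly \<Rightarrow> xpoly \<Rightarrow> bool" where
  "\<lbrakk>M \<in> Poly_Mapping.keys p; leftmost_at M i j k;
    M = N + {#(i, j), (j, k)#}; c = Poly_Mapping.lookup p M\<rbrakk>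
   \<Longrightarrow> replacement p
         (p - Poly_Mapping.single M c
            + Poly_Mapping.single N c * (xvar i k * xvar i j + xvar j k * xvar i k + beta * xvar i k))"

definition is_reduced :: "xpoly \<Rightarrow> bool" where
  "is_reduced p \<longleftrightarrow> (\<forall>M\<in>Poly_Mapping.keys p. \<forall>i j k. \<not> reducible_at M i j k)"

text \<open>
  Every monomial has at most one leftmost reducible product, and replacements terminate, so the
  order in which the terms of a polynomial are processed does not affect the reduced polynomial.
\<close>

definition reduced_polynomial :: "monomial \<Rightarrow> xpoly" where
  "reduced_polynomial M =
     (THE p. replacement\<^sup>*\<^sup>* (Poly_Mapping.single M 1) p \<and> is_reduced p)"

text \<open>The polynomial \<open>P\<^sub>M(\<beta>)\<close>.\<close>

definition reduced_value :: "monomial \<Rightarrow> int poly" where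
  "reduced_value M = eval_at (\<lambda>_. 1) (reduced_polynomial M)"

definition up_down_up_permutations :: "nat \<Rightarrow> nat \<Rightarrow> (nat \<Rightarrow> nat) set" where
  "up_down_up_permutations n k = {\<sigma>. \<sigma> permutes {1..2*n+k+1} \<and>
     (\<forall>i\<in>{1..n}. \<sigma> i < \<sigma> (i + 1)) \<and>
     (\<forall>i\<in>{n+1..2*n}. \<sigma> i > \<sigma> (i + 1)) \<and>
     (\<forall>i\<in>{2*n+1..2*n+k}. \<sigma> i < \<sigma> (i + 1))}"

end

theory Submission imports Defs begin

text \<open>
  The polynomial reached from a monomial is unique because the normal form, extended linearly, is
  invariant under replacements.  At \<open>\<beta> = 0\<close> and \<open>x\<^sub>i\<^sub>j = 1\<close> every replacement is a Pascal-type
  recursion for the number of terms.  The replacements of \<open>x\<^sub>1\<^sub>2 x\<^sub>2\<^sub>3\<close> come first; if they leave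
  \<open>x\<^sub>1\<^sub>2\<^bsup>i\<^esup>\<close>, there are \<open>2n - i\<close> factors \<open>x\<^sub>1\<^sub>3\<close> and the remaining steps give
  \<open>(2n - i + k choose k)\<close> terms, and if no \<open>x\<^sub>1\<^sub>2\<close> remains they give \<open>(2n + k choose k)\<close>.  On the
  other side, a permutation with value \<open>i + 1\<close> at the valley has all of \<open>1, \<dots>, i\<close> before the peak;
  choosing the final \<open>k\<close> values and then the other values before the peak, which must avoid the
  maximum, gives the same summand for every \<open>i\<close>.
\<close>

section \<open>The number of terms of the reduced polynomial\<close>

text \<open>Since \<open>i < j\<close>, the pairs \<open>(i, j)\<close> and \<open>(j, k)\<close>
  differ, so multiset inclusion amounts to two memberships.\<close>

lemma reducible_at_iff:
  "reducible_at M i j k \<longleftrightarrow> i < j \<and> j < k \<and> (i, j) \<in># M \<and> (j, k) \<in># M"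
  unfolding reducible_at_def
  by (auto simp: insert_subset_eq_iff in_diff_count count_eq_zero_iff)

lemma leftmost_at_exists:
  assumes "reducible_at M i j k"
  shows "\<exists>i j k. leftmost_at M i j k"
proof -
  define i0 where "i0 = (LEAST i. \<exists>j k. reducible_at M i j k)"
  define j0 where "j0 = (LEAST j. \<exists>k. reducible_at M i0 j k)"
  define k0 where "k0 = (LEAST k. reducible_at M i0 j0 k)"
  have 1: "\<exists>j k. reducible_at M i0 j k"
    unfolding i0_def by (rule LeastI) (use assms in blast)
  then have 2: "\<exists>k. reducible_at M i0 j0 k"
    unfolding j0_def by (auto intro: LeastI)
  then have 3: "reducible_at M i0 j0 k0"
    unfolding k0_def by (auto intro: LeastI)
  have "i0 \<le> i'" if "reducible_at M i' j' k'" for i' j' k'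
    unfolding i0_def using that by (auto intro: Least_le)
  moreover have "j0 \<le> j'" if "reducible_at M i0 j' k'" for j' k'
    unfolding j0_def using that by (auto intro: Least_le)
  moreover have "k0 \<le> k'" if "reducible_at M i0 j0 k'" for k'
    unfolding k0_def using that by (auto intro: Least_le)
  ultimately have "leftmost_at M i0 j0 k0"
    unfolding leftmost_at_def using 3 by (metis le_neq_implies_less)
  then show ?thesis by blast
qed

lemma leftmost_at_unique:
  assumes "leftmost_at M i j k" "leftmost_at M i' j' k'"
  shows "i' = i \<and> j' = j \<and> k' = k"
proof -
  have "reducible_at M i j k" "reducible_at M i' j' k'"
    using assms by (auto simp: leftmost_at_def)
  then have "i < i' \<or> (i = i' \<and> (j < j' \<or> (j = j' \<and> k \<le> k')))"
    "i' < i \<or> (i' = i \<and> (j' < j \<or> (j' = j \<and> k' \<le> k)))"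
    using assms unfolding leftmost_at_def by blast+
  then show ?thesis by linarith
qed

lemma leftmost_atD:
  assumes "leftmost_at M i j k"
  shows "i < j" "j < k" "(i, j) \<in># M" "(j, k) \<in># M" "\<exists>N. M = N + {#(i, j), (j, k)#}"
  using assms unfolding leftmost_at_def reducible_at_def
  by (auto dest: mset_subset_eqD simp: subset_mset.le_iff_add add.commute)

section \<open>Termination of the replacements\<close>

definition children :: "monomial \<Rightarrow> nat \<Rightarrow> nat \<Rightarrow> nat \<Rightarrow> monomial set" where
  "children N i j k =
     {N + {#(i, k), (i, j)#}, N + {#(j, k), (i, k)#}, N + {#(i, k)#}}"

definition max_index :: "monomial \<Rightarrow> nat" where
  "max_index M = Max (insert 0 (snd ` set_mset M))"

text \<open>If \<open>B\<close> bounds all indices, every pair has positive weight and longer pairs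
  weigh less. A replacement lengthens one of two pairs or merges both into one, so the total weight
  drops.\<close>

definition deficit :: "nat \<Rightarrow> monomial \<Rightarrow> nat" where
  "deficit B M = (\<Sum>(i, j)\<in>#M. Suc B - (j - i))"

text \<open>No child contains a new right index, so parent and child can first be compared under the
  parent's bound. Monotonicity in the bound then passes to the child's own.\<close>

lemma children_deficit_less:
  assumes "M' \<in> children N i j k" "i < j" "j < k"
  shows "deficit (max_index M') M' < deficit (max_index (N + {#(i, j), (j, k)#})) (N + {#(i, j), (j, k)#})"
proof -
  let ?M = "N + {#(i, j), (j, k)#}"
  have mono: "deficit B M' \<le> deficit B' M'" if "B \<le> B'" for B B'
    unfolding deficit_def using that by (intro sum_mset_mono) auto
  have "max_index M' \<le> max_index ?M"
    using assms unfolding max_index_def children_def by (intro Max_mono) auto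
  \<comment> \<open>This keeps the truncated subtractions exact for all three pairs, which makes the
    decrease strict.\<close>
  moreover have "k \<le> max_index ?M"
    unfolding max_index_def by (intro Max_ge) auto
  then have "deficit (max_index ?M) M' < deficit (max_index ?M) ?M"
    using assms unfolding children_def deficit_def by auto
  ultimately show ?thesis using mono by (meson order.strict_trans1)
qed

definition child_rel :: "(monomial \<times> monomial) set" where
  "child_rel = {(M', M). \<exists>N i j k. M = N + {#(i, j), (j, k)#} \<and> i < j \<and> j < k \<and> M' \<in> children N i j k}"

lemma wf_child_rel: "wf child_rel"
  by (rule wf_subset[OF wf_measure[of "\<lambda>M. deficit (max_index M) M"]])
    (unfold child_rel_def, clarify, simp only: in_measure, rule children_deficit_less)

lemma child_relI:
  assumes "leftmost_at M i j k" "M' \<in> children (M - {#(i, j), (j, k)#}) i j k"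
  shows "(M', M) \<in> child_rel"
proof -
  obtain N where "M = N + {#(i, j), (j, k)#}" using leftmost_atD(5)[OF assms(1)] by blast
  moreover from this have "M - {#(i, j), (j, k)#} = N" by (simp only: add_diff_cancel_right')
  ultimately show ?thesis
    unfolding child_rel_def using assms(2) leftmost_atD(1,2)[OF assms(1)] by simp blast
qed

section \<open>The normal form and its linear extension\<close>

definition leftmost :: "monomial \<Rightarrow> nat \<times> nat \<times> nat" where
  "leftmost M = (SOME (i, j, k). leftmost_at M i j k)"

lemma leftmost_eq:
  assumes "leftmost_at M i j k" shows "leftmost M = (i, j, k)"
  unfolding leftmost_def
  by (rule some_equality) (use assms leftmost_at_unique in auto)

text \<open>On an irreducible monomial \<open>leftmost\<close> is an arbitrary triple, hence the
  test before recursing.\<close>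

function normal_form :: "monomial \<Rightarrow> xpoly" where
  "normal_form M = (case leftmost M of (i, j, k) \<Rightarrow>
     if leftmost_at M i j k then
       normal_form (M - {#(i, j), (j, k)#} + {#(i, k), (i, j)#})
       + normal_form (M - {#(i, j), (j, k)#} + {#(j, k), (i, k)#})
       + beta * normal_form (M - {#(i, j), (j, k)#} + {#(i, k)#})
     else Poly_Mapping.single M 1)"
  by pat_completeness auto
termination
proof (relation child_rel)
  show "wf child_rel" by (rule wf_child_rel)
qed (auto intro!: child_relI simp: children_def)

declare normal_form.simps [simp del]

lemma normal_form_step:
  assumes "leftmost_at (N + {#(i, j), (j, k)#}) i j k"
  shows "normal_form (N + {#(i, j), (j, k)#}) =
    normal_form (N + {#(i, k), (i, j)#}) + normal_form (N + {#(j, k), (i, k)#})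
    + beta * normal_form (N + {#(i, k)#})"
proof -
  have *: "N + {#(i, j), (j, k)#} - {#(i, j), (j, k)#} = N" by (rule add_diff_cancel_right')
  show ?thesis
    by (subst normal_form.simps) (simp only: leftmost_eq[OF assms] prod.case assms if_True *)
qed

lemma normal_form_irreducible:
  assumes "\<And>i j k. \<not> reducible_at M i j k"
  shows "normal_form M = Poly_Mapping.single M 1"
  using assms by (subst normal_form.simps) (auto simp: leftmost_at_def split: prod.split)

text \<open>The index \<open>0\<close> is the empty monomial, so the factor
  \<open>Poly_Mapping.single 0 c\<close> is the constant \<open>c\<close>.\<close>

definition normalize :: "xpoly \<Rightarrow> xpoly" where
  "normalize p = (\<Sum>M\<in>Poly_Mapping.keys p.
     Poly_Mapping.single 0 (Poly_Mapping.lookup p M) * normal_form M)"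

lemma normalize_add: "normalize (p + q) = normalize p + normalize q"
  unfolding normalize_def by (rule setsum_keys_plus_distrib) (simp_all add: single_add distrib_right)

lemma normalize_single: "normalize (Poly_Mapping.single M c) = Poly_Mapping.single 0 c * normal_form M"
  by (cases "c = 0") (simp_all add: normalize_def)

lemma replacement_expand:
  "Poly_Mapping.single N c * (xvar i k * xvar i j + xvar j k * xvar i k + beta * xvar i k) =
    Poly_Mapping.single (N + {#(i, k), (i, j)#}) c + Poly_Mapping.single (N + {#(j, k), (i, k)#}) c
    + Poly_Mapping.single (N + {#(i, k)#}) (c * [:0, 1:])"
  by (simp add: xvar_def beta_def mult_single distrib_left add_ac)

text \<open>The removed term and the three inserted terms have the same normalization, because the
  recursion of \<open>normal_form\<close> uses the same leftmost product.\<close>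

lemma normalize_replacement:
  assumes "replacement p q"
  shows "normalize q = normalize p"
  using assms
proof cases
  case (1 M i j k N c)
  let ?s = "Poly_Mapping.single"
  have "normalize p = normalize (p - ?s M c) + normalize (?s M c)"
    by (simp flip: normalize_add)
  also have "normalize (?s M c) =
    normalize (?s N c * (xvar i k * xvar i j + xvar j k * xvar i k + beta * xvar i k))"
    unfolding replacement_expand normalize_add normalize_single 1(4)
    by (subst normal_form_step)
      (use 1 in \<open>simp_all add: distrib_left beta_def mult_single flip: mult.assoc\<close>)
  finally show ?thesis using 1 by (simp add: normalize_add)
qed

lemma normalize_reduced:
  assumes "is_reduced p"
  shows "normalize p = p"
proof -
  have "normalize p = (\<Sum>M\<in>Poly_Mapping.keys p. Poly_Mapping.single M (Poly_Mapping.lookup p M))"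
    unfolding normalize_def using assms
    by (intro sum.cong) (auto simp: is_reduced_def normal_form_irreducible mult_single)
  also have "\<dots> = p"
    by (rule poly_mapping_eqI) (simp add: lookup_sum lookup_single when_def in_keys_iff)
  finally show ?thesis .
qed

text \<open>The monomial \<open>M\<close> leaves the support, and whatever enters it is a child of
  \<open>M\<close>; cancellation can only remove further monomials. This is a descent in the
  multiset extension of \<open>child_rel\<close>, with the common keys as context.\<close>

lemma replacement_keys_decreasing:
  assumes "replacement p q"
  shows "(mset_set (Poly_Mapping.keys q), mset_set (Poly_Mapping.keys p)) \<in> mult child_rel"
  using assms
proof cases
  case (1 M i j k N c)
  let ?s = "Poly_Mapping.single"
  have child: "(M', M) \<in> child_rel" if "M' \<in> children N i j k" for M'
    using that 1(4) leftmost_atD(1,2)[OF 1(3)] unfolding child_rel_def by blast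
  \<comment> \<open>Otherwise an inserted term could bring \<open>M\<close> back into the
    support.\<close>
  have "M \<notin> children N i j k"
    using child wf_child_rel by (meson wf_not_refl)
  have q: "q = p - ?s M c + (?s (N + {#(i, k), (i, j)#}) c + ?s (N + {#(j, k), (i, k)#}) c
    + ?s (N + {#(i, k)#}) (c * [:0, 1:]))"
    using 1 by (simp only: replacement_expand)
  have lookup_q: "Poly_Mapping.lookup q M' = Poly_Mapping.lookup (p - ?s M c) M'"
    if "M' \<notin> children N i j k" for M'
    using that unfolding q by (auto simp: lookup_add lookup_single children_def when_def)
  have M: "M \<notin> Poly_Mapping.keys q"
    using lookup_q[OF \<open>M \<notin> _\<close>] 1 by (simp add: in_keys_iff lookup_minus)
  have sub: "Poly_Mapping.keys q - Poly_Mapping.keys p \<subseteq> children N i j k"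
  proof
    fix M' assume M': "M' \<in> Poly_Mapping.keys q - Poly_Mapping.keys p"
    then have "M' \<noteq> M" using 1(2) by blast
    then show "M' \<in> children N i j k"
      using lookup_q[of M'] M' by (auto simp: in_keys_iff lookup_minus lookup_single_not_eq)
  qed
  let ?I = "mset_set (Poly_Mapping.keys p \<inter> Poly_Mapping.keys q)"
  have split: "mset_set A = mset_set (B \<inter> A) + mset_set (A - B)" if "finite A" for A B :: "monomial set"
  proof -
    have "A = B \<inter> A \<union> (A - B)" by blast
    then show ?thesis using that by (metis mset_set_Union Int_Diff_disjoint Int_commute finite_Diff finite_Int)
  qed
  have "(?I + mset_set (Poly_Mapping.keys q - Poly_Mapping.keys p),
    ?I + mset_set (Poly_Mapping.keys p - Poly_Mapping.keys q)) \<in> mult child_rel"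
    using M sub child 1(2) by (intro one_step_implies_mult) (auto simp: mset_set_empty_iff)
  then show ?thesis
    using split[of "Poly_Mapping.keys q" "Poly_Mapping.keys p"]
      split[of "Poly_Mapping.keys p" "Poly_Mapping.keys q"]
    by (simp add: Int_commute)
qed

lemma reduced_exists: "\<exists>q. replacement\<^sup>*\<^sup>* p q \<and> is_reduced q"
proof (induction p rule: wf_induct_rule[OF wf_inv_image[OF wf_mult[OF wf_child_rel],
      of "\<lambda>p. mset_set (Poly_Mapping.keys p)"]])
  case (1 p)
  show ?case
  proof (cases "is_reduced p")
    case False
    then obtain M i j k where M: "M \<in> Poly_Mapping.keys p" "leftmost_at M i j k"
      unfolding is_reduced_def using leftmost_at_exists by blast
    then obtain N where N: "M = N + {#(i, j), (j, k)#}"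
      using leftmost_atD(5)[OF M(2)] by blast
    obtain q where q: "replacement p q"
      using replacement.intros[OF M N refl] by blast
    then obtain r where "replacement\<^sup>*\<^sup>* q r" "is_reduced r"
      using 1 replacement_keys_decreasing[OF q] by auto
    then show ?thesis using q by (meson converse_rtranclp_into_rtranclp)
  qed blast
qed

text \<open>A reduced polynomial equals its own normalization, which by invariance is that of the
  initial monomial. This gives the uniqueness behind \<open>THE\<close>; existence comes from
  termination.\<close>

lemma reduced_polynomial_eq: "reduced_polynomial M = normal_form M"
proof -
  have inv: "normalize q = normalize p" if "replacement\<^sup>*\<^sup>* p q" for p q
    using that by (induction rule: rtranclp_induct) (simp_all add: normalize_replacement)
  have *: "q = normal_form M" if "replacement\<^sup>*\<^sup>* (Poly_Mapping.single M 1) q" "is_reduced q" for q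
    using inv[OF that(1)] normalize_reduced[OF that(2)] by (simp add: normalize_single)
  obtain q where "replacement\<^sup>*\<^sup>* (Poly_Mapping.single M 1) q" "is_reduced q"
    using reduced_exists by blast
  then show ?thesis
    unfolding reduced_polynomial_def using * by (intro the_equality) auto
qed

section \<open>Evaluation at \<open>\<beta> = 0\<close> and all variables 1\<close>

lemma eval_at_add: "eval_at f (p + q) = eval_at f p + eval_at f q"
  unfolding eval_at_def by (rule setsum_keys_plus_distrib) (simp_all add: distrib_right)

lemma eval_at_single: "eval_at f (Poly_Mapping.single M c) = c * (\<Prod>e\<in>#M. f e)"
  by (cases "c = 0") (simp_all add: eval_at_def)

lemma eval_at_scale: "eval_at f (Poly_Mapping.single 0 c * p) = c * eval_at f p"
proof -
  have lookup: "Poly_Mapping.lookup (Poly_Mapping.single 0 c * p) M = c * Poly_Mapping.lookup p M" for M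
    by (simp add: Poly_Mapping.map.rep_eq when_def flip: mult_map_scale_conv_mult)
  have "eval_at f (Poly_Mapping.single 0 c * p) =
    (\<Sum>M\<in>Poly_Mapping.keys p. c * Poly_Mapping.lookup p M * (\<Prod>e\<in>#M. f e))"
    unfolding eval_at_def lookup by (rule sum.mono_neutral_left) (auto simp: in_keys_iff lookup)
  then show ?thesis by (simp add: eval_at_def sum_distrib_left mult.assoc)
qed

definition term_count :: "monomial \<Rightarrow> int" where
  "term_count M = poly (reduced_value M) 0"

text \<open>The third branch carries the factor \<open>[:0, 1:]\<close>, which vanishes at
  0.\<close>

lemma term_count_step:
  assumes "leftmost_at (N + {#(i, j), (j, k)#}) i j k"
  shows "term_count (N + {#(i, j), (j, k)#}) =
    term_count (N + {#(i, k), (i, j)#}) + term_count (N + {#(j, k), (i, k)#})"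
  unfolding term_count_def reduced_value_def reduced_polynomial_eq normal_form_step[OF assms]
  using eval_at_scale[of _ "[:0, 1:]"] by (simp add: eval_at_add beta_def)

lemma term_count_irreducible:
  assumes "\<And>i j k. \<not> reducible_at M i j k"
  shows "term_count M = 1"
  unfolding term_count_def reduced_value_def reduced_polynomial_eq
    normal_form_irreducible[OF assms] by (simp add: eval_at_single)

section \<open>Monomials with indices in 1, 2, 3, 4\<close>

definition edge_monomial :: "nat \<Rightarrow> nat \<Rightarrow> nat \<Rightarrow> nat \<Rightarrow> nat \<Rightarrow> nat \<Rightarrow> monomial" where
  "edge_monomial a b c d e f = replicate_mset a (1, 2) + replicate_mset b (2, 3) + replicate_mset c (1, 3)
     + replicate_mset d (3, 4) + replicate_mset e (2, 4) + replicate_mset f (1, 4)"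

lemma in_edge_monomial:
  "x \<in># edge_monomial a b c d e f \<longleftrightarrow>
     x = (1, 2) \<and> a > 0 \<or> x = (2, 3) \<and> b > 0 \<or> x = (1, 3) \<and> c > 0 \<or>
     x = (3, 4) \<and> d > 0 \<or> x = (2, 4) \<and> e > 0 \<or> x = (1, 4) \<and> f > 0"
  unfolding edge_monomial_def union_iff in_replicate_mset by argo

text \<open>The four increasing triples from 1, 2, 3, 4 appear in lexicographic order, so a product
  is leftmost exactly when all those listed before it are absent.\<close>

lemma reducible_at_edge_monomial:
  "reducible_at (edge_monomial a b c d e f) i j k \<longleftrightarrow>
     (i, j, k) = (1, 2, 3) \<and> a > 0 \<and> b > 0 \<or> (i, j, k) = (1, 2, 4) \<and> a > 0 \<and> e > 0 \<or>
     (i, j, k) = (1, 3, 4) \<and> c > 0 \<and> d > 0 \<or> (i, j, k) = (2, 3, 4) \<and> b > 0 \<and> d > 0"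
  unfolding reducible_at_iff in_edge_monomial prod.inject by (rule iffI; elim conjE disjE; simp)

text \<open>The triple (1, 2, 3) precedes all others, so this step applies whatever the remaining
  exponents are.\<close>

lemma term_count_123:
  "term_count (edge_monomial (Suc a) (Suc b) c d e f) =
     term_count (edge_monomial (Suc a) b (Suc c) d e f) + term_count (edge_monomial a (Suc b) (Suc c) d e f)"
proof -
  let ?N = "edge_monomial a b c d e f"
  have "edge_monomial (Suc a) (Suc b) c d e f = ?N + {#(1, 2), (2, 3)#}"
    "edge_monomial (Suc a) b (Suc c) d e f = ?N + {#(1, 3), (1, 2)#}"
    "edge_monomial a (Suc b) (Suc c) d e f = ?N + {#(2, 3), (1, 3)#}"
    by (simp_all add: edge_monomial_def add_mset_commute)
  moreover have "leftmost_at (edge_monomial (Suc a) (Suc b) c d e f) 1 2 3"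
    unfolding leftmost_at_def reducible_at_edge_monomial by auto
  ultimately show ?thesis using term_count_step by metis
qed

text \<open>The hypothesis rules out the two earlier triples (1, 2, 3) and (1, 2, 4).\<close>

lemma term_count_134:
  assumes "a = 0 \<or> b = 0 \<and> e = 0"
  shows "term_count (edge_monomial a b (Suc c) (Suc d) e f) =
     term_count (edge_monomial a b (Suc c) d e (Suc f)) + term_count (edge_monomial a b c (Suc d) e (Suc f))"
proof -
  let ?N = "edge_monomial a b c d e f"
  have "edge_monomial a b (Suc c) (Suc d) e f = ?N + {#(1, 3), (3, 4)#}"
    "edge_monomial a b (Suc c) d e (Suc f) = ?N + {#(1, 4), (1, 3)#}"
    "edge_monomial a b c (Suc d) e (Suc f) = ?N + {#(3, 4), (1, 4)#}"
    by (simp_all add: edge_monomial_def add_mset_commute)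
  moreover have "leftmost_at (edge_monomial a b (Suc c) (Suc d) e f) 1 3 4"
    unfolding leftmost_at_def reducible_at_edge_monomial using assms by auto
  ultimately show ?thesis using term_count_step by metis
qed

lemma term_count_234:
  "term_count (edge_monomial 0 (Suc b) 0 (Suc d) e f) =
     term_count (edge_monomial 0 (Suc b) 0 d (Suc e) f) + term_count (edge_monomial 0 b 0 (Suc d) (Suc e) f)"
proof -
  let ?N = "edge_monomial 0 b 0 d e f"
  have "edge_monomial 0 (Suc b) 0 (Suc d) e f = ?N + {#(2, 3), (3, 4)#}"
    "edge_monomial 0 (Suc b) 0 d (Suc e) f = ?N + {#(2, 4), (2, 3)#}"
    "edge_monomial 0 b 0 (Suc d) (Suc e) f = ?N + {#(3, 4), (2, 4)#}"
    by (simp_all add: edge_monomial_def add_mset_commute)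
  moreover have "leftmost_at (edge_monomial 0 (Suc b) 0 (Suc d) e f) 2 3 4"
    unfolding leftmost_at_def reducible_at_edge_monomial by auto
  ultimately show ?thesis using term_count_step by metis
qed

text \<open>Each step is Pascal's rule. Once \<open>b\<close> or \<open>d\<close> is 0 the monomial
  is irreducible and the binomial coefficient is 1.\<close>

lemma term_count_x23_x34: "term_count (edge_monomial 0 b 0 d e f) = int ((b + d) choose d)"
proof (induction "b + d" arbitrary: b d e)
  case 0
  then show ?case by (simp add: term_count_irreducible reducible_at_edge_monomial)
next
  case (Suc m)
  show ?case
  proof (cases b; cases d)
    fix b' d' assume "b = Suc b'" "d = Suc d'"
    then show ?thesis
      using Suc.hyps(1)[of b d' "Suc e"] Suc.hyps(1)[of b' d "Suc e"] Suc.hyps(2)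
      by (simp add: term_count_234)
  qed (simp_all add: term_count_irreducible reducible_at_edge_monomial)
qed

text \<open>The factors \<open>x\<^sub>1\<^sub>2\<close> are inert: neither
  \<open>x\<^sub>2\<^sub>3\<close> nor \<open>x\<^sub>2\<^sub>4\<close> is present, and the steps at
  (1, 3, 4) create none.\<close>

lemma term_count_x12_x13_x34: "term_count (edge_monomial a 0 c d 0 f) = int ((c + d) choose d)"
proof (induction "c + d" arbitrary: c d f)
  case 0
  then show ?case by (simp add: term_count_irreducible reducible_at_edge_monomial)
next
  case (Suc m)
  show ?case
  proof (cases c; cases d)
    fix c' d' assume "c = Suc c'" "d = Suc d'"
    then show ?thesis
      using Suc.hyps(1)[of c d' "Suc f"] Suc.hyps(1)[of c' d "Suc f"] Suc.hyps(2)
      by (simp add: term_count_134)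
  qed (simp_all add: term_count_irreducible reducible_at_edge_monomial)
qed

text \<open>The steps at (1, 3, 4) come first and follow Pascal's rule. When
  \<open>x\<^sub>1\<^sub>3\<close> runs out, the surviving \<open>x\<^sub>3\<^sub>4\<close> meet
  \<open>x\<^sub>2\<^sub>3\<close>, and the boundary value is the binomial coefficient found for
  those two.\<close>

lemma term_count_x23_x13_x34: "term_count (edge_monomial 0 b c d 0 f) = int ((b + c + d) choose d)"
proof (induction "c + d" arbitrary: c d f)
  case 0
  then show ?case by (simp add: term_count_irreducible reducible_at_edge_monomial)
next
  case (Suc m)
  show ?case
  proof (cases c; cases d)
    fix c' d' assume "c = Suc c'" "d = Suc d'"
    then show ?thesis
      using Suc.hyps(1)[of c d' "Suc f"] Suc.hyps(1)[of c' d "Suc f"] Suc.hyps(2)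
      by (simp add: term_count_134)
  qed (simp_all add: term_count_irreducible reducible_at_edge_monomial term_count_x23_x34)
qed

text \<open>
  The \<open>x\<^sub>1\<^sub>2 x\<^sub>2\<^sub>3\<close> steps form lattice paths from \<open>(a, b)\<close>.  For \<open>i > 0\<close> the first factor counts those
  that first meet an axis at \<open>(i, 0)\<close>, for \<open>i = 0\<close> those that first meet it at some \<open>(0, j)\<close>, all of
  which have equal weight.  Truncated subtraction makes the formula valid on the axes too.
\<close>

definition path_sum :: "nat \<Rightarrow> nat \<Rightarrow> nat \<Rightarrow> nat \<Rightarrow> nat" where
  "path_sum N d a b = (\<Sum>i\<le>a. ((a - i + b - 1) choose (a - i)) * ((N - i + d) choose d))"

lemma path_sum_zero_left: "path_sum N d 0 b = (N + d) choose d"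
  by (simp add: path_sum_def)

lemma path_sum_zero_right: "path_sum N d a 0 = (N - a + d) choose d"
proof -
  \<comment> \<open>With \<open>m = a - i > 0\<close> the first factor is
    \<open>(m - 1) choose m = 0\<close>; at \<open>i = a\<close> truncation turns it into
    \<open>0 choose 0 = 1\<close>.\<close>
  have "path_sum N d a 0 = (\<Sum>i\<le>a. if i = a then (N - a + d) choose d else 0)"
    unfolding path_sum_def by (intro sum.cong) auto
  then show ?thesis by simp
qed

text \<open>For \<open>i \<le> a\<close> the summands obey Pascal's rule. The summand
  \<open>i = Suc a\<close> has first factor 1 on the left and in the first sum on the right, and
  does not occur in the second.\<close>

lemma path_sum_Suc: "path_sum N d (Suc a) (Suc b) = path_sum N d (Suc a) b + path_sum N d a (Suc b)"
proof -
  have "((Suc a - i + Suc b - 1) choose (Suc a - i)) =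
    ((Suc a - i + b - 1) choose (Suc a - i)) + ((a - i + Suc b - 1) choose (a - i))" if "i \<le> a" for i
  proof -
    have "Suc a - i = Suc (a - i)" using that by simp
    then show ?thesis by simp
  qed
  then have "(\<Sum>i\<le>a. ((Suc a - i + Suc b - 1) choose (Suc a - i)) * ((N - i + d) choose d)) =
    (\<Sum>i\<le>a. ((Suc a - i + b - 1) choose (Suc a - i)) * ((N - i + d) choose d)) +
    (\<Sum>i\<le>a. ((a - i + Suc b - 1) choose (a - i)) * ((N - i + d) choose d))"
    by (subst sum.distrib[symmetric], intro sum.cong refl) (simp add: distrib_right)
  then show ?thesis by (simp add: path_sum_def)
qed

text \<open>The steps at (1, 2, 3) preserve \<open>a + b + c\<close>, so the first argument of
  \<open>path_sum\<close> stays fixed and both sides satisfy one recursion with the same values on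
  the axes.\<close>

lemma term_count_edge_monomial: "term_count (edge_monomial a b c d 0 f) = int (path_sum (a + b + c) d a b)"
proof (induction "a + b" arbitrary: a b c)
  case 0
  then show ?case by (simp add: path_sum_zero_left term_count_x23_x13_x34)
next
  case (Suc m)
  show ?case
  proof (cases a; cases b)
    fix a' b' assume "a = Suc a'" "b = Suc b'"
    then show ?thesis
      using Suc.hyps(1)[of a b' "Suc c"] Suc.hyps(1)[of a' b "Suc c"] Suc.hyps(2)
      by (simp add: term_count_123 path_sum_Suc)
  qed (simp_all add: term_count_x23_x13_x34 term_count_x12_x13_x34 path_sum_zero_left path_sum_zero_right)
qed

lemma repeat_mset_edge_monomial:
  "repeat_mset n {#(1, 2), (2, 3)#} + replicate_mset k (3, 4) = edge_monomial n n 0 k 0 0"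
  by (simp add: edge_monomial_def multiset_eq_iff)

section \<open>Counting the permutations\<close>

text \<open>
  The pair records the values before the peak and the values after the valley; the values from the
  peak down to the valley are the rest.  The two conditions say that the peak exceeds the former
  and the valley is below the latter.
\<close>

definition split_pairs :: "nat \<Rightarrow> nat \<Rightarrow> (nat set \<times> nat set) set" where
  "split_pairs n k = {(L, K). L \<subseteq> {1..2*n+k+1} \<and> K \<subseteq> {1..2*n+k+1} - L \<and> card L = n \<and> card K = k \<and>
     (\<forall>x\<in>L. \<exists>y\<in>{1..2*n+k+1} - L - K. x < y) \<and> (\<forall>x\<in>K. \<exists>y\<in>{1..2*n+k+1} - L - K. y < x)}"

section \<open>Monotone maps on intervals\<close>

lemma increasing_interval:
  fixes f :: "nat \<Rightarrow> nat"
  assumes f: "\<And>i. a \<le> i \<Longrightarrow> i < b \<Longrightarrow> f i < f (i + 1)" and "a \<le> r" "r < s" "s \<le> b"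
  shows "f r < f s"
proof -
  have "Suc r \<le> s" using assms by simp
  then show ?thesis using \<open>s \<le> b\<close>
  proof (induction s rule: dec_induct)
    case base
    then show ?case using f[of r] assms by simp
  next
    case (step m)
    then have "a \<le> m" "m < b" using assms by linarith+
    then show ?case using f[of m] step by simp
  qed
qed

lemma decreasing_interval:
  fixes f :: "nat \<Rightarrow> nat"
  assumes f: "\<And>i. a \<le> i \<Longrightarrow> i < b \<Longrightarrow> f i > f (i + 1)" and "a \<le> r" "r < s" "s \<le> b"
  shows "f r > f s"
proof -
  have "Suc r \<le> s" using assms by simp
  then show ?thesis using \<open>s \<le> b\<close>
  proof (induction s rule: dec_induct)
    case base
    then show ?case using f[of r] assms by simp
  next
    case (step m)
    then have "a \<le> m" "m < b" using assms by linarith+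
    then show ?case using f[of m] step by simp
  qed
qed

text \<open>Both maps list the common image in sorted order.\<close>

lemma increasing_determined_by_image:
  fixes f g :: "nat \<Rightarrow> nat"
  assumes "\<And>r s. a \<le> r \<Longrightarrow> r < s \<Longrightarrow> s \<le> b \<Longrightarrow> f r < f s"
    and "\<And>r s. a \<le> r \<Longrightarrow> r < s \<Longrightarrow> s \<le> b \<Longrightarrow> g r < g s"
    and "f ` {a..b} = g ` {a..b}" "i \<in> {a..b}"
  shows "f i = g i"
proof -
  have *: "sorted_list_of_set (h ` {a..b}) = map h [a..<Suc b]"
    if "\<And>r s. a \<le> r \<Longrightarrow> r < s \<Longrightarrow> s \<le> b \<Longrightarrow> h r < h s" for h :: "nat \<Rightarrow> nat"
  proof -
    have "sorted_wrt (<) (map h [a..<Suc b])"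
      unfolding sorted_wrt_map by (rule sorted_wrt_mono_rel[OF _ sorted_wrt_upt]) (auto intro: that)
    then have "sorted_list_of_set (set (map h [a..<Suc b])) = map h [a..<Suc b]"
      by (simp only: strict_sorted_iff sorted_list_of_set.idem_if_sorted_distinct)
    then show ?thesis by (simp only: set_map set_upt atLeastLessThanSuc_atLeastAtMost)
  qed
  have "map f [a..<Suc b] = map g [a..<Suc b]"
    using *[of f] *[of g] assms by simp
  then have "\<forall>j\<in>{a..b}. f j = g j"
    by (simp only: map_eq_conv set_upt atLeastLessThanSuc_atLeastAtMost)
  then show ?thesis using assms(4) by blast
qed

text \<open>The reflection \<open>j \<mapsto> a + b - j\<close> of the interval reduces this to the
  increasing case.\<close>

lemma decreasing_determined_by_image:
  fixes f g :: "nat \<Rightarrow> nat"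
  assumes f: "\<And>r s. a \<le> r \<Longrightarrow> r < s \<Longrightarrow> s \<le> b \<Longrightarrow> f r > f s"
    and g: "\<And>r s. a \<le> r \<Longrightarrow> r < s \<Longrightarrow> s \<le> b \<Longrightarrow> g r > g s"
    and "f ` {a..b} = g ` {a..b}" "i \<in> {a..b}"
  shows "f i = g i"
proof -
  have rev: "(\<lambda>j. a + b - j) ` {a..b} = {a..b}"
  proof (intro equalityI subsetI)
    fix x assume "x \<in> {a..b}"
    then show "x \<in> (\<lambda>j. a + b - j) ` {a..b}"
      by (intro image_eqI[of _ _ "a + b - x"]) auto
  qed auto
  have "f (a + b - (a + b - i)) = g (a + b - (a + b - i))"
  proof (rule increasing_determined_by_image[of a b "\<lambda>j. f (a + b - j)" "\<lambda>j. g (a + b - j)"])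
    show "(\<lambda>j. f (a + b - j)) ` {a..b} = (\<lambda>j. g (a + b - j)) ` {a..b}"
      using assms(3) rev by (metis image_image)
  qed (use assms(4) in \<open>auto intro: f g\<close>)
  then show ?thesis using assms(4) by simp
qed

section \<open>The bijection between permutations and split pairs\<close>

lemma up_down_upD:
  assumes "\<sigma> \<in> up_down_up_permutations n k"
  shows "\<sigma> permutes {1..2*n+k+1}"
    and "1 \<le> r \<Longrightarrow> r < s \<Longrightarrow> s \<le> n + 1 \<Longrightarrow> \<sigma> r < \<sigma> s"
    and "n + 1 \<le> r \<Longrightarrow> r < s \<Longrightarrow> s \<le> 2*n+1 \<Longrightarrow> \<sigma> r > \<sigma> s"
    and "2*n+1 \<le> r \<Longrightarrow> r < s \<Longrightarrow> s \<le> 2*n+k+1 \<Longrightarrow> \<sigma> r < \<sigma> s"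
proof -
  have 1: "\<sigma> permutes {1..2*n+k+1}" and 2: "\<forall>i\<in>{1..n}. \<sigma> i < \<sigma> (i + 1)"
    and 3: "\<forall>i\<in>{n+1..2*n}. \<sigma> i > \<sigma> (i + 1)"
    and 4: "\<forall>i\<in>{2*n+1..2*n+k}. \<sigma> i < \<sigma> (i + 1)"
    using assms unfolding up_down_up_permutations_def by auto
  show "\<sigma> permutes {1..2*n+k+1}" by (rule 1)
  show "1 \<le> r \<Longrightarrow> r < s \<Longrightarrow> s \<le> n + 1 \<Longrightarrow> \<sigma> r < \<sigma> s"
    by (rule increasing_interval[of 1 "n+1"]) (use 2 in auto)
  show "n + 1 \<le> r \<Longrightarrow> r < s \<Longrightarrow> s \<le> 2*n+1 \<Longrightarrow> \<sigma> r > \<sigma> s"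
    by (rule decreasing_interval[of "n+1" "2*n+1"]) (use 3 in auto)
  show "2*n+1 \<le> r \<Longrightarrow> r < s \<Longrightarrow> s \<le> 2*n+k+1 \<Longrightarrow> \<sigma> r < \<sigma> s"
    by (rule increasing_interval[of "2*n+1" "2*n+k+1"]) (use 4 in auto)
qed

definition split_perm :: "nat \<Rightarrow> nat \<Rightarrow> (nat \<Rightarrow> nat) \<Rightarrow> nat set \<times> nat set" where
  "split_perm n k \<sigma> = (\<sigma> ` {1..n}, \<sigma> ` {2*n+2..2*n+k+1})"

lemma image_middle:
  fixes n k :: nat
  assumes "\<sigma> permutes {1..2*n+k+1}"
  shows "\<sigma> ` {n+1..2*n+1} = {1..2*n+k+1} - \<sigma> ` {1..n} - \<sigma> ` {2*n+2..2*n+k+1}"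
proof -
  have "{n+1..2*n+1} = {1..2*n+k+1} - {1..n} - {2*n+2..2*n+k+1}" by auto
  then show ?thesis
    using permutes_inj[OF assms] permutes_image[OF assms] by (metis image_set_diff)
qed

lemma split_perm_in:
  assumes "\<sigma> \<in> up_down_up_permutations n k"
  shows "split_perm n k \<sigma> \<in> split_pairs n k"
proof -
  note s = up_down_upD[OF assms]
  have inj: "inj \<sigma>" using permutes_inj[OF s(1)] .
  let ?R = "{1..2*n+k+1} - \<sigma> ` {1..n} - \<sigma> ` {2*n+2..2*n+k+1}"
  \<comment> \<open>Peak and valley are the witnesses for the two conditions in
    \<open>split_pairs\<close>.\<close>
  have R: "\<sigma> (n + 1) \<in> ?R" "\<sigma> (2*n+1) \<in> ?R"
    unfolding image_middle[OF s(1), symmetric] by (intro imageI; simp)+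
  have sub: "\<sigma> ` A \<subseteq> {1..2*n+k+1}" if "A \<subseteq> {1..2*n+k+1}" for A
    using that permutes_image[OF s(1)] by blast
  have "\<sigma> ` {1..n} \<inter> \<sigma> ` {2*n+2..2*n+k+1} = {}"
    using inj by (auto simp: inj_eq)
  moreover have "card (\<sigma> ` A) = card A" for A
    using inj by (meson card_image inj_on_subset subset_UNIV)
  moreover have "\<exists>y\<in>?R. x < y" if "x \<in> \<sigma> ` {1..n}" for x
    using that s(2)[of _ "n + 1"] by (intro bexI[OF _ R(1)]) auto
  moreover have "\<exists>y\<in>?R. y < x" if "x \<in> \<sigma> ` {2*n+2..2*n+k+1}" for x
    using that s(4)[of "2*n+1"] by (intro bexI[OF _ R(2)]) auto
  ultimately show ?thesis
    unfolding split_pairs_def split_perm_def using sub[of "{1..n}"] sub[of "{2*n+2..2*n+k+1}"] by auto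
qed

text \<open>The pair fixes the image of each of the three runs, and a monotone run is determined by
  its image.\<close>

lemma inj_on_split_perm: "inj_on (split_perm n k) (up_down_up_permutations n k)"
proof (rule inj_onI)
  fix \<sigma> \<tau>
  assume st: "\<sigma> \<in> up_down_up_permutations n k" "\<tau> \<in> up_down_up_permutations n k"
    and eq: "split_perm n k \<sigma> = split_perm n k \<tau>"
  note s = up_down_upD[OF st(1)] and t = up_down_upD[OF st(2)]
  have eqs: "\<sigma> ` {1..n} = \<tau> ` {1..n}" "\<sigma> ` {2*n+2..2*n+k+1} = \<tau> ` {2*n+2..2*n+k+1}"
    using eq by (simp_all add: split_perm_def)
  then have mid: "\<sigma> ` {n+1..2*n+1} = \<tau> ` {n+1..2*n+1}"
    by (simp only: image_middle[OF s(1)] image_middle[OF t(1)])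
  show "\<sigma> = \<tau>"
  proof
    fix i
    consider "i \<in> {1..n}" | "i \<in> {n+1..2*n+1}" | "i \<in> {2*n+2..2*n+k+1}" | "i \<notin> {1..2*n+k+1}"
      by fastforce
    then show "\<sigma> i = \<tau> i"
    proof cases
      case 1
      show ?thesis
        by (rule increasing_determined_by_image[OF _ _ eqs(1) 1]) (auto intro: s t)
    next
      case 2
      show ?thesis
        by (rule decreasing_determined_by_image[OF _ _ mid 2]) (auto intro: s t)
    next
      case 3
      show ?thesis
        by (rule increasing_determined_by_image[OF _ _ eqs(2) 3]) (auto intro: s t)
    next
      case 4
      then show ?thesis using permutes_not_in[OF s(1)] permutes_not_in[OF t(1)] by simp
    qed
  qed
qed

lemma split_perm_surj:
  assumes "(L, K) \<in> split_pairs n k"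
  shows "(L, K) \<in> split_perm n k ` up_down_up_permutations n k"
proof -
  define N where "N = 2*n+k+1"
  define R where "R = {1..N} - L - K"
  have L: "L \<subseteq> {1..N}" "card L = n" "finite L" and K: "K \<subseteq> {1..N} - L" "card K = k" "finite K"
    and LR: "\<And>x. x \<in> L \<Longrightarrow> \<exists>y\<in>R. x < y" and KR: "\<And>x. x \<in> K \<Longrightarrow> \<exists>y\<in>R. y < x"
    using assms finite_subset[of _ "{1..N}"] unfolding split_pairs_def N_def R_def by auto
  have R: "card R = n + 1" "finite R"
    using L K by (simp_all add: R_def card_Diff_subset N_def)
  define A B C where "A = sorted_list_of_set L" and "B = sorted_list_of_set R"
    and "C = sorted_list_of_set K"
  have len: "length A = n" "length B = n + 1" "length C = k"
    using L K R by (simp_all add: A_def B_def C_def)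
  have set: "set A = L" "set B = R" "set C = K"
    using L K R by (simp_all add: A_def B_def C_def)
  have sorted: "sorted_wrt (<) A" "sorted_wrt (<) B" "sorted_wrt (<) C"
    by (simp_all add: A_def B_def C_def)
  \<comment> \<open>\<open>B\<close> is increasing and is read backwards, from \<open>B ! n\<close>
    at the peak down to \<open>B ! 0\<close> at the valley.\<close>
  define \<sigma> where "\<sigma> i = (if i \<in> {1..n} then A ! (i - 1)
    else if i \<in> {n+1..2*n+1} then B ! (2*n+1 - i)
    else if i \<in> {2*n+2..N} then C ! (i - (2*n+2)) else i)" for i
  have imL: "\<sigma> ` {1..n} = L"
  proof -
    have "\<sigma> ` {1..n} = (\<lambda>t. A ! t) ` (\<lambda>i. i - 1) ` {1..n}"
      by (auto simp: \<sigma>_def image_image intro!: image_cong)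
    also have "(\<lambda>i. i - 1) ` {1..n} = {..<n}"
    proof (intro equalityI subsetI)
      fix x assume "x \<in> {..<n}"
      then show "x \<in> (\<lambda>i. i - 1) ` {1..n}"
        by (intro image_eqI[of _ _ "x + 1"]) auto
    qed auto
    finally show ?thesis using nth_image[of n A] len set by (simp add: lessThan_atLeast0)
  qed
  have imR: "\<sigma> ` {n+1..2*n+1} = R"
  proof -
    have "\<sigma> ` {n+1..2*n+1} = (\<lambda>t. B ! t) ` (\<lambda>i. 2*n+1 - i) ` {n+1..2*n+1}"
      by (auto simp: \<sigma>_def image_image intro!: image_cong)
    also have "(\<lambda>i. 2*n+1 - i) ` {n+1..2*n+1} = {..<n+1}"
    proof (intro equalityI subsetI)
      fix x assume "x \<in> {..<n+1}"
      then show "x \<in> (\<lambda>i. 2*n+1 - i) ` {n+1..2*n+1}"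
        by (intro image_eqI[of _ _ "2*n+1 - x"]) auto
    qed auto
    finally show ?thesis using nth_image[of "n+1" B] len set by (simp add: lessThan_atLeast0)
  qed
  have imK: "\<sigma> ` {2*n+2..N} = K"
  proof -
    have "\<sigma> ` {2*n+2..N} = (\<lambda>t. C ! t) ` (\<lambda>i. i - (2*n+2)) ` {2*n+2..N}"
      by (auto simp: \<sigma>_def image_image intro!: image_cong)
    also have "(\<lambda>i. i - (2*n+2)) ` {2*n+2..N} = {..<k}"
    proof (intro equalityI subsetI)
      fix x assume "x \<in> {..<k}"
      then show "x \<in> (\<lambda>i. i - (2*n+2)) ` {2*n+2..N}"
        by (intro image_eqI[of _ _ "x + (2*n+2)"]) (auto simp: N_def)
    qed (auto simp: N_def)
    finally show ?thesis using nth_image[of k C] len set by (simp add: lessThan_atLeast0)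
  qed
  have "{1..N} = {1..n} \<union> {n+1..2*n+1} \<union> {2*n+2..N}" by (auto simp: N_def)
  then have im: "\<sigma> ` {1..N} = {1..N}"
    using imL imR imK L K by (auto simp only: image_Un R_def)
  have "\<sigma> permutes {1..N}"
  proof (rule bij_imp_permutes)
    \<comment> \<open>A surjective self-map of a finite set is injective.\<close>
    show "bij_betw \<sigma> {1..N} {1..N}"
      using im by (simp add: bij_betw_def eq_card_imp_inj_on)
  qed (auto simp: \<sigma>_def N_def)
  moreover have "\<sigma> i < \<sigma> (i + 1)" if "i \<in> {1..n}" for i
  proof (cases "i = n")
    case True
    have "\<sigma> i \<in> L" using imL that by blast
    then obtain t where t: "t < n + 1" "\<sigma> i < B ! t"
      using LR len set by (metis in_set_conv_nth)
    \<comment> \<open>The last ascent before the peak joins two lists: some element of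
      \<open>R\<close> exceeds \<open>\<sigma> i\<close>, hence so does the maximum of
      \<open>R\<close>.\<close>
    have "B ! t \<le> B ! n"
      using t sorted_wrt_nth_less[OF sorted(2), of t n] len by (cases "t = n") auto
    then show ?thesis using t True by (simp add: \<sigma>_def)
  next
    case False
    then show ?thesis
      using that sorted_wrt_nth_less[OF sorted(1), of "i - 1" i] len by (auto simp: \<sigma>_def)
  qed
  moreover have "\<sigma> i > \<sigma> (i + 1)" if "i \<in> {n+1..2*n}" for i
    using that sorted_wrt_nth_less[OF sorted(2), of "2*n+1 - (i+1)" "2*n+1-i"] len
    by (auto simp: \<sigma>_def)
  moreover have "\<sigma> i < \<sigma> (i + 1)" if "i \<in> {2*n+1..2*n+k}" for i
  proof (cases "i = 2*n+1")
    case True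
    have "\<sigma> (i + 1) \<in> K" using imK that True by (auto simp: N_def)
    then obtain t where t: "t < n + 1" "B ! t < \<sigma> (i + 1)"
      using KR len set by (metis in_set_conv_nth)
    \<comment> \<open>Dually, the valley holds the minimum of \<open>R\<close>.\<close>
    have "B ! 0 \<le> B ! t"
      using t sorted_wrt_nth_less[OF sorted(2), of 0 t] len by (cases "t = 0") auto
    moreover have "\<sigma> i = B ! 0" using True by (simp add: \<sigma>_def)
    ultimately show ?thesis using t by simp
  next
    case False
    then show ?thesis
      using that sorted_wrt_nth_less[OF sorted(3), of "i - (2*n+2)" "i + 1 - (2*n+2)"] len
      by (auto simp: \<sigma>_def N_def)
  qed
  ultimately have "\<sigma> \<in> up_down_up_permutations n k"
    unfolding up_down_up_permutations_def N_def by blast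
  moreover have "split_perm n k \<sigma> = (L, K)"
    using imL imK by (simp add: split_perm_def N_def)
  ultimately show ?thesis by (metis imageI)
qed

lemma card_up_down_up: "card (up_down_up_permutations n k) = card (split_pairs n k)"
proof -
  have "bij_betw (split_perm n k) (up_down_up_permutations n k) (split_pairs n k)"
  proof (rule bij_betw_imageI[OF inj_on_split_perm], intro equalityI subsetI)
    fix p assume "p \<in> split_perm n k ` up_down_up_permutations n k"
    then show "p \<in> split_pairs n k" using split_perm_in by blast
  next
    fix p assume "p \<in> split_pairs n k"
    then show "p \<in> split_perm n k ` up_down_up_permutations n k"
      using split_perm_surj by (cases p) simp
  qed
  then show ?thesis by (rule bij_betw_same_card)
qed

section \<open>Counting split pairs by the value at the valley\<close>

definition upper_choices :: "nat \<Rightarrow> nat \<Rightarrow> nat \<Rightarrow> nat set set" where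
  "upper_choices n k i = {K. K \<subseteq> {i+2..2*n+k+1} \<and> card K = k}"

text \<open>Here and in \<open>upper_choices\<close>, \<open>i + 1\<close> is the value at the
  valley and \<open>1, ..., i\<close> lie before the peak, so choices start at \<open>i + 2\<close>.
  The largest value outside \<open>K\<close> is the peak and cannot be chosen.\<close>

definition lower_choices :: "nat \<Rightarrow> nat \<Rightarrow> nat \<Rightarrow> nat set \<Rightarrow> nat set set" where
  "lower_choices n k i K = {L. L \<subseteq> {i+2..2*n+k+1} - K - {Max ({i+2..2*n+k+1} - K)} \<and> card L = n - i}"

lemma card_rest:
  assumes "i \<le> n" "K \<in> upper_choices n k i"
  shows "card ({i+2..2*n+k+1} - K) = 2*n - i"
proof -
  have "finite K" using assms by (auto simp: upper_choices_def intro: finite_subset)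
  then show ?thesis using assms by (auto simp: upper_choices_def card_Diff_subset)
qed

text \<open>The set has \<open>2*n - i \<ge> n > 0\<close> elements, so its maximum is
  meaningful.\<close>

lemma Max_rest:
  assumes "n > 0" "i \<le> n" "K \<in> upper_choices n k i"
  shows "Max ({i+2..2*n+k+1} - K) \<in> {i+2..2*n+k+1} - K"
proof (rule Max_in)
  show "{i+2..2*n+k+1} - K \<noteq> {}"
  proof
    assume empty: "{i+2..2*n+k+1} - K = {}"
    have "2*n - i = 0" using card_rest[OF assms(2,3)] unfolding empty by simp
    then show False using assms(1,2) by linarith
  qed
qed simp

text \<open>There are \<open>k\<close> of \<open>2*n - i + k\<close> values to choose for
  \<open>K\<close>, then \<open>n - i\<close> of \<open>2*n - i - 1\<close> for \<open>L\<close>, a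
  number independent of \<open>K\<close>. The product is the summand of \<open>path_sum\<close> at
  \<open>i\<close>.\<close>

lemma card_choices:
  assumes "n > 0"
  shows "card (SIGMA i:{..n}. SIGMA K:upper_choices n k i. lower_choices n k i K) = path_sum (2*n) k n n"
proof -
  have fin: "finite (upper_choices n k i)" "finite (lower_choices n k i K)" for i K
    unfolding upper_choices_def lower_choices_def by (auto intro: finite_subset[of _ "Pow {i+2..2*n+k+1}"])
  have lower: "card (lower_choices n k i K) = (n - i + n - 1) choose (n - i)"
    if "i \<le> n" "K \<in> upper_choices n k i" for i K
  proof -
    have "card ({i+2..2*n+k+1} - K - {Max ({i+2..2*n+k+1} - K)}) = 2*n - i - 1"
      using card_rest[OF that] Max_rest[OF assms that] by (simp add: card_Diff_singleton)
    then show ?thesis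
      unfolding lower_choices_def using n_subsets[of "{i+2..2*n+k+1} - K - {Max ({i+2..2*n+k+1} - K)}" "n - i"] that(1)
      by (simp add: mult_2)
  qed
  have upper: "card (upper_choices n k i) = (2*n - i + k) choose k" if "i \<le> n" for i
    using n_subsets[of "{i+2..2*n+k+1}" k] that by (simp add: upper_choices_def)
  have "card (SIGMA K:upper_choices n k i. lower_choices n k i K)
    = ((n - i + n - 1) choose (n - i)) * ((2*n - i + k) choose k)" if "i \<le> n" for i
    using that by (simp add: card_SigmaI fin lower upper)
  then show ?thesis
    unfolding path_sum_def by (subst card_SigmaI) (auto simp: fin intro!: finite_SigmaI)
qed

lemma bij_betw_choices:
  assumes "n > 0"
  shows "bij_betw (\<lambda>(i, K, L). ({1..i} \<union> L, K))
    (SIGMA i:{..n}. SIGMA K:upper_choices n k i. lower_choices n k i K) (split_pairs n k)"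
proof -
  define N where "N = 2*n+k+1"
  let ?S = "SIGMA i:{..n}. SIGMA K:upper_choices n k i. lower_choices n k i K"
  let ?f = "\<lambda>(i, K, L). ({1..i} \<union> L, K)"
  \<comment> \<open>The valley value is the minimum of the middle set, which recovers
    \<open>i\<close>.\<close>
  let ?m = "\<lambda>L K. Min ({1..N} - L - K) - 1"
  let ?g = "\<lambda>(L, K). (?m L K, K, L - {1..?m L K})"
  have fwd: "({1..i} \<union> L, K) \<in> split_pairs n k \<and> Min ({1..N} - ({1..i} \<union> L) - K) = i + 1"
    if i: "i \<le> n" and K: "K \<in> upper_choices n k i" and L: "L \<in> lower_choices n k i K" for i K L
  proof -
    let ?Z = "{i+2..N} - K" and ?R = "{1..N} - ({1..i} \<union> L) - K"
    have M: "Max ?Z \<in> ?Z" using Max_rest[OF assms i K] by (simp add: N_def)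
    have K': "K \<subseteq> {i+2..N}" "card K = k" using K by (auto simp: upper_choices_def N_def)
    have L': "L \<subseteq> ?Z - {Max ?Z}" "card L = n - i" using L by (auto simp: lower_choices_def N_def)
    have "finite L" using L' by (meson finite_Diff finite_atLeastAtMost finite_subset)
    have iR: "i + 1 \<in> ?R" using K' L' i by (auto simp: N_def)
    have MR: "Max ?Z \<in> ?R" using M L' by auto
    have "Min ?R = i + 1" using iR by (intro Min_eqI) auto
    moreover have "card ({1..i} \<union> L) = n"
    proof -
      have "{1..i} \<inter> L = {}" using L' by auto
      then show ?thesis using \<open>finite L\<close> L' i by (simp add: card_Un_disjoint)
    qed
    \<comment> \<open>Elements of \<open>L\<close> lie below the peak \<open>Max ?Z\<close>;
      elements of \<open>{1..i}\<close> already lie below the valley value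
      \<open>i + 1\<close>.\<close>
    moreover have "\<exists>y\<in>?R. x < y" if "x \<in> {1..i} \<union> L" for x
    proof (cases "x \<in> L")
      case True
      then have "x \<le> Max ?Z" "x \<noteq> Max ?Z" using L' by (auto intro: Max_ge)
      then show ?thesis using MR by (metis le_neq_implies_less)
    next
      case False
      then show ?thesis using that iR by (intro bexI[OF _ iR]) auto
    qed
    moreover have "\<exists>y\<in>?R. y < x" if "x \<in> K" for x
      using that K' by (intro bexI[OF _ iR]) auto
    moreover have "{1..i} \<union> L \<subseteq> {1..N}" "K \<subseteq> {1..N} - ({1..i} \<union> L)"
      using K' L' i by (auto simp: N_def)
    ultimately show ?thesis using K' by (simp add: split_pairs_def N_def)
  qed
  have bwd: "?m L K \<le> n \<and> K \<in> upper_choices n k (?m L K) \<and> L - {1..?m L K} \<in> lower_choices n k (?m L K) K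
      \<and> {1..?m L K} \<subseteq> L" if "(L, K) \<in> split_pairs n k" for L K
  proof -
    let ?R = "{1..N} - L - K"
    define v where "v = Min ?R"
    have L: "L \<subseteq> {1..N}" "card L = n" "finite L" and K: "K \<subseteq> {1..N} - L" "card K = k" "finite K"
      and LR: "\<And>x. x \<in> L \<Longrightarrow> \<exists>y\<in>?R. x < y" and KR: "\<And>x. x \<in> K \<Longrightarrow> \<exists>y\<in>?R. y < x"
      using that finite_subset[of _ "{1..N}"] unfolding split_pairs_def N_def by auto
    have "card ?R = n + 1"
      using L K by (simp add: card_Diff_subset N_def)
    then have "?R \<noteq> {}" by (metis Suc_eq_plus1 card.empty nat.distinct(1))
    then have v: "v \<in> ?R" unfolding v_def by (intro Min_in) auto
    have v_le: "v \<le> y" if "y \<in> ?R" for y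
      unfolding v_def using that by (intro Min_le) auto
    have K_gt: "v < x" if "x \<in> K" for x
      using KR[OF that] v_le by (meson le_less_trans)
    \<comment> \<open>Values below \<open>v\<close> are neither in the middle set, whose minimum is
      \<open>v\<close>, nor in \<open>K\<close>, all of which exceeds \<open>v\<close>.\<close>
    have sub: "{1..v - 1} \<subseteq> L"
    proof
      fix x assume "x \<in> {1..v - 1}"
      then show "x \<in> L" using v v_le[of x] K_gt[of x] by fastforce
    qed
    then have vn: "v - 1 \<le> n" using card_mono[OF L(3) sub] L(2) by simp
    \<comment> \<open>This uses \<open>v \<ge> 1\<close>, since the subtraction is
      truncated.\<close>
    have v1: "v - 1 + 2 = v + 1" using v by auto
    have "K \<in> upper_choices n k (v - 1)"
      unfolding upper_choices_def v1 using K K_gt by (auto simp: N_def Suc_le_eq)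
    moreover have "x \<in> {v+1..N} - K - {Max ({v+1..N} - K)}" if x: "x \<in> L - {1..v - 1}" for x
    proof -
      have "x \<noteq> v" "x \<in> {1..N}" "x \<notin> K" using x v L K by auto
      then have "x > v" using x by auto
      \<comment> \<open>The middle value \<open>y\<close> above \<open>x\<close> also exceeds
        \<open>v\<close> and avoids \<open>K\<close>, so \<open>x\<close> is not the maximum that
        \<open>lower_choices\<close> excludes.\<close>
      obtain y where y: "y \<in> ?R" "x < y" using LR x by blast
      then have "y \<in> {v+1..N} - K" using \<open>x > v\<close> by auto
      then have "y \<le> Max ({v+1..N} - K)" by (intro Max_ge) auto
      then have "x \<noteq> Max ({v+1..N} - K)" using y by linarith
      then show ?thesis using \<open>x > v\<close> \<open>x \<in> {1..N}\<close> \<open>x \<notin> K\<close> by auto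
    qed
    moreover have "card (L - {1..v - 1}) = n - (v - 1)"
      using card_Diff_subset[OF _ sub] L by simp
    ultimately have "L - {1..v - 1} \<in> lower_choices n k (v - 1) K"
      unfolding lower_choices_def v1 N_def[symmetric] by blast
    then show ?thesis
      using vn sub \<open>K \<in> upper_choices n k (v - 1)\<close> unfolding v_def by blast
  qed
  show ?thesis
  proof (rule bij_betw_byWitness[where f' = ?g])
    show "\<forall>t\<in>?S. ?g (?f t) = t"
    proof
      fix t assume "t \<in> ?S"
      then obtain i K L where t: "t = (i, K, L)" and
        *: "i \<in> {..n}" "K \<in> upper_choices n k i" "L \<in> lower_choices n k i K"
        by blast
      then have "L \<inter> {1..i} = {}" by (auto simp: lower_choices_def)
      then have "{1..i} \<union> L - {1..i} = L" by blast
      then show "?g (?f t) = t"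
        using fwd[of i K L] * unfolding t by simp
    qed
    show "\<forall>p\<in>split_pairs n k. ?f (?g p) = p"
      using bwd by fastforce
    show "?f ` ?S \<subseteq> split_pairs n k"
      using fwd by fastforce
    show "?g ` split_pairs n k \<subseteq> ?S"
      using bwd by fastforce
  qed
qed

lemma card_up_down_up_path_sum:
  assumes "n > 0"
  shows "card (up_down_up_permutations n k) = path_sum (2*n) k n n"
  using card_choices[OF assms] bij_betw_same_card[OF bij_betw_choices[OF assms]]
  by (simp only: card_up_down_up)

lemma card_up_down_up_path_sum_zero: "card (up_down_up_permutations 0 0) = path_sum 0 0 0 0"
proof -
  have "up_down_up_permutations 0 0 = {id}"
    by (auto simp: up_down_up_permutations_def permutes_sing)
  then show ?thesis by (simp add: path_sum_def)
qed

theorem proposition5p10: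
  fixes n k :: nat
  assumes "k \<le> n"
  shows "poly (reduced_value
            (repeat_mset n {#(1, 2), (2, 3)#} + replicate_mset k (3, 4))) 0
         = int (card (up_down_up_permutations n k))"
proof -
  have "poly (reduced_value (repeat_mset n {#(1, 2), (2, 3)#} + replicate_mset k (3, 4))) 0
    = int (path_sum (2*n) k n n)"
    using term_count_edge_monomial[of n n 0 k 0] by (simp only: repeat_mset_edge_monomial term_count_def mult_2 add_0_right)
  \<comment> \<open>If \<open>n = 0\<close>, the hypothesis forces \<open>k = 0\<close>, and the
    identity is the only permutation.\<close>
  also have "path_sum (2*n) k n n = card (up_down_up_permutations n k)"
    using assms card_up_down_up_path_sum[of n k] card_up_down_up_path_sum_zero by (cases "n = 0") auto
  finally show ?thesis .
qed

end
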